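(* Let $n$ be a (sufficiently large) prime. For every $0 < \gamma < 1$, there exists a constant $c = c(\gamma) > 0$ such that, for every sufficiently large set $X \subseteq \mathbb{Z}_n$, every $d \in \mathbb{N}$ and every $0 < \varepsilon < \gamma$, the following holds. If $X$ has $\varepsilon$-robust Freiman dimension $d$ and $Y \subseteq X + X$ satisfies $$\big|\{(x_1, x_2) \in X^2 : x_1 + x_2 \notin Y\}\big| \le c \varepsilon |X|^2,$$ then $|Y| \ge (1 - \gamma)(d + 1)|X|/2$.
   Context: $X + X = \{x_1 + x_2 : x_1, x_2 \in X\}$. A Freiman homomorphism is a map $\phi : X \to Y$ between subsets of abelian groups such that $a_1 + b_1 = a_2 + b_2$ implies $\phi(a_1) + \phi(b_1) = \phi(a_2) + \phi(b_2)$; a Freiman isomorphism is a bijection such that $\phi$ and $\phi^{-1}$ are Freiman homomorphisms. A set $S \subseteq \mathbb{R}^d$ has full rank if it is not contained in any affine subspace of dimension less than $d$. The Freiman dimension $\dim_{\mathrm{F}}(X)$ is the largest $d$ for which there is a full rank subset of $\mathbb{Z}^d$ Freiman isomorphic to $X$. $X$ has $\varepsilon$-robust Freiman dimension $d$ if $\dim_{\mathrm{F}}(X) \ge d$ and there is no $X' \subseteq X$ with $|X'| \ge (1 - \varepsilon)|X|$ and $\dim_{\mathrm{F}}(X') < d$. *)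

theory Defs
  imports
    "HOL-Analysis.Finite_Function_Topology"
    "HOL-Algebra.Free_Abelian_Groups"
    "HOL-Computational_Algebra.Primes"
begin

text \<open>
  Abelian groups are HOL-Algebra structures, so the group operation is written multiplicatively.
  The group of residues modulo \<open>n\<close> is \<open>integer_mod_group n\<close>, and \<open>A <#>\<^bsub>G\<^esub> B\<close> is the sumset
  of \<open>A\<close> and \<open>B\<close>.
\<close>

definition freiman_hom ::
  "('a, 'm) monoid_scheme \<Rightarrow> ('b, 'k) monoid_scheme \<Rightarrow> 'a set \<Rightarrow> 'b set \<Rightarrow> ('a \<Rightarrow> 'b) \<Rightarrow> bool"
  where "freiman_hom G H A B \<phi> \<longleftrightarrow>
    A \<subseteq> carrier G \<and> B \<subseteq> carrier H \<and> \<phi> \<in> A \<rightarrow> B \<and>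
    (\<forall>a1\<in>A. \<forall>b1\<in>A. \<forall>a2\<in>A. \<forall>b2\<in>A.
      a1 \<otimes>\<^bsub>G\<^esub> b1 = a2 \<otimes>\<^bsub>G\<^esub> b2 \<longrightarrow> \<phi> a1 \<otimes>\<^bsub>H\<^esub> \<phi> b1 = \<phi> a2 \<otimes>\<^bsub>H\<^esub> \<phi> b2)"

definition freiman_iso ::
  "('a, 'm) monoid_scheme \<Rightarrow> ('b, 'k) monoid_scheme \<Rightarrow> 'a set \<Rightarrow> 'b set \<Rightarrow> ('a \<Rightarrow> 'b) \<Rightarrow> bool"
  where "freiman_iso G H A B \<phi> \<longleftrightarrow>
    bij_betw \<phi> A B \<and> freiman_hom G H A B \<phi> \<and> freiman_hom H G B A (inv_into A \<phi>)"

text \<open>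
  Since the dimension is quantified over, vectors are finitely supported functions on the naturals:
  \<open>int_space d\<close> and \<open>real_space d\<close> consist of those supported on the coordinates below \<open>d\<close>.
\<close>

abbreviation int_space :: "nat \<Rightarrow> (nat \<Rightarrow>\<^sub>0 int) monoid"
  where "int_space d \<equiv> free_Abelian_group {..<d}"

definition real_space :: "nat \<Rightarrow> (nat \<Rightarrow>\<^sub>0 real) set"
  where "real_space d = {v. Poly_Mapping.keys v \<subseteq> {..<d}}"

definition real_vec :: "(nat \<Rightarrow>\<^sub>0 int) \<Rightarrow> (nat \<Rightarrow>\<^sub>0 real)"
  where "real_vec v = Poly_Mapping.map real_of_int v"

text \<open>Affine subspaces are the translates of linear subspaces, with the same dimension.\<close>

definition full_rank :: "nat \<Rightarrow> (nat \<Rightarrow>\<^sub>0 real) set \<Rightarrow> bool"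
  where "full_rank d S \<longleftrightarrow>
    S \<subseteq> real_space d \<and>
    \<not> (\<exists>a W. a \<in> real_space d \<and> subspace W \<and> W \<subseteq> real_space d \<and> dim W < d \<and>
              S \<subseteq> (+) a ` W)"

text \<open>
  For finite \<open>X\<close> the set below is bounded, because a full rank set in dimension \<open>d \<ge> 1\<close> has at least
  \<open>d + 1\<close> points, so \<open>Sup\<close> is its maximum.  The set is empty if \<open>X\<close> is not Freiman isomorphic to any
  set of integer vectors (for instance, the whole group of residues modulo \<open>n\<close>, for \<open>n \<ge> 2\<close>); then
  \<open>freiman_dim\<close> is \<open>0\<close>, as \<open>Sup {} = 0\<close> on the naturals.  This does not affect
  \<open>robust_freiman_dim\<close> for \<open>d \<ge> 1\<close> and \<open>\<epsilon> < 1\<close>: it forces \<open>X\<close>, hence each of its nonempty subsets, to be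
  Freiman isomorphic to a full rank set.
\<close>

definition freiman_dim :: "('a, 'm) monoid_scheme \<Rightarrow> 'a set \<Rightarrow> nat"
  where "freiman_dim G X =
    Sup {d. \<exists>S \<phi>. S \<subseteq> carrier (int_space d) \<and> full_rank d (real_vec ` S) \<and>
                  freiman_iso G (int_space d) X S \<phi>}"

definition robust_freiman_dim :: "('a, 'm) monoid_scheme \<Rightarrow> real \<Rightarrow> 'a set \<Rightarrow> nat \<Rightarrow> bool"
  where "robust_freiman_dim G \<epsilon> X d \<longleftrightarrow>
    freiman_dim G X \<ge> d \<and>
    \<not> (\<exists>X' \<subseteq> X. real (card X') \<ge> (1 - \<epsilon>) * real (card X) \<and> freiman_dim G X' < d)"

end

theory Submission
  imports Defs "Jordan_Normal_Form.Determinant"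
begin

text \<open>
  Removing from \<open>X\<close> the few elements that occur in many missing pairs leaves, by robustness, a set
  \<open>X'\<close> which some map respecting additive relations sends onto a full rank subset of \<open>\<int>\<^sup>e\<close>, with
  \<open>e \<ge> d\<close>.  Choose \<open>b\<^sub>0, \<dots>, b\<^sub>e\<close> in \<open>X'\<close> whose images span a simplex of maximal volume, and let
  \<open>\<lambda>\<^sub>i\<close> be the barycentric coordinates with respect to it.  If a sum \<open>s\<close> is represented as
  \<open>a\<^sub>i + b\<^sub>i\<close> for \<open>i \<in> I\<close>, then replacing \<open>b\<^sub>i\<close> by \<open>a\<^sub>i\<close> for all \<open>i \<in> I\<close> multiplies the volume by
  \<open>|1 - \<Sum>\<^sub>i (1 + \<lambda>\<^sub>i(a\<^sub>i))|\<close>, so by maximality the weights \<open>1 + \<lambda>\<^sub>i(a\<^sub>i)\<close> of the representations of \<open>s\<close>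
  add up to at most \<open>2\<close>.  The weights of all pairs \<open>(a, b\<^sub>i)\<close> add up to \<open>(e + 2)|X'|\<close>, hence
  \<open>|X' + {b\<^sub>0, \<dots>, b\<^sub>e}| \<ge> (e + 2)|X'|/2\<close>.  Only \<open>e + 1\<close> translates are involved, and each loses at
  most a small multiple of \<open>|X|\<close> sums outside \<open>Y\<close>, so the bound passes to \<open>Y\<close>.
\<close>

section \<open>Determinants of rank one perturbations\<close>

text \<open>Sylvester's identity: one block matrix factors both as \<open>?L * ?P\<close> and as
  \<open>?Q * ?L\<close>. The unitriangular \<open>?L\<close> has determinant 1, while
  \<open>?P\<close> and \<open>?Q\<close> are block triangular and carry the two sides.\<close>

lemma det_one_plus_mult_commute:
  fixes A :: "'a :: idom mat"
  assumes A: "A \<in> carrier_mat n m" and B: "B \<in> carrier_mat m n"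
  shows "det (1\<^sub>m n + A * B) = det (1\<^sub>m m + B * A)"
proof -
  let ?L = "four_block_mat (1\<^sub>m n) (0\<^sub>m n m) B (1\<^sub>m m)"
  let ?P = "four_block_mat (1\<^sub>m n + A * B) A (0\<^sub>m m n) (1\<^sub>m m)"
  let ?Q = "four_block_mat (1\<^sub>m n) A (0\<^sub>m m n) (1\<^sub>m m + B * A)"
  have LP: "?L * ?P = four_block_mat (1\<^sub>m n + A * B) A (B + B * A * B) (1\<^sub>m m + B * A)"
    using A B
    by (subst mult_four_block_mat[where ?nr1.0 = n and ?nr2.0 = m and ?n1.0 = n and ?n2.0 = m
          and ?nc1.0 = n and ?nc2.0 = m])
      (auto simp: mult_add_distrib_mat[of B m n "1\<^sub>m n" n "A * B"] assoc_mult_mat[of B m n A m B n]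
        comm_add_mat[of "B * A" m m "1\<^sub>m m"])
  have QL: "?Q * ?L = four_block_mat (1\<^sub>m n + A * B) A (B + B * A * B) (1\<^sub>m m + B * A)"
    using A B
    by (subst mult_four_block_mat[where ?nr1.0 = n and ?nr2.0 = m and ?n1.0 = n and ?n2.0 = m
          and ?nc1.0 = n and ?nc2.0 = m])
      (auto simp: add_mult_distrib_mat[of "1\<^sub>m m" m m "B * A" B n])
  have L: "det ?L = 1"
    using A B by (subst det_four_block_mat_upper_right_zero[of _ n _ m]) auto
  have P: "det ?P = det (1\<^sub>m n + A * B)"
    using A B by (subst det_four_block_mat_lower_left_zero[of _ n _ m]) auto
  have Q: "det ?Q = det (1\<^sub>m m + B * A)"
    using A B by (subst det_four_block_mat_lower_left_zero[of _ n _ m]) auto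
  have "det ?L * det ?P = det ?Q * det ?L"
    using A B LP QL
    by (subst (1 2) det_mult[symmetric, of _ "n + m"]) auto
  then show ?thesis
    using L P Q by simp
qed

lemma det_one_minus_outer:
  fixes u v :: "nat \<Rightarrow> 'a :: idom"
  shows "det (mat n n (\<lambda>(i, j). (if i = j then 1 else 0) - u i * v j)) = 1 - (\<Sum>i<n. u i * v i)"
proof -
  let ?U = "mat n 1 (\<lambda>(i, _). u i)" and ?V = "mat 1 n (\<lambda>(_, j). - v j)"
  have "mat n n (\<lambda>(i, j). (if i = j then 1 else 0) - u i * v j) = 1\<^sub>m n + ?U * ?V"
    by (rule eq_matI) (auto simp: scalar_prod_def)
  moreover have "det (1\<^sub>m 1 + ?V * ?U) = 1 - (\<Sum>i<n. u i * v i)"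
    by (subst det_single)
      (auto simp: scalar_prod_def sum_negf atLeast0LessThan mult.commute)
  ultimately show ?thesis
    using det_one_plus_mult_commute[of ?U n 1 ?V] by simp
qed

text \<open>The matrix is a sign flip \<open>?E\<close> of the rows in \<open>I\<close> times the
  identity minus the outer product of the indicator of \<open>I\<close> with \<open>s\<close>. It
  gives the volume ratio when the vertices in \<open>I\<close> of a simplex are reflected.\<close>

lemma abs_det_reflected_rows:
  fixes s :: "nat \<Rightarrow> real"
  assumes "I \<subseteq> {..<n}"
  shows "\<bar>det (mat n n (\<lambda>(i, j). if i \<in> I then s j - (if i = j then 1 else 0) else (if i = j then 1 else 0)))\<bar>
    = \<bar>1 - sum s I\<bar>"
proof -
  let ?K = "mat n n (\<lambda>(i, j). (if i = j then 1 else 0) - (if i \<in> I then 1 else 0) * s j)"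
  let ?E = "mat_diag n (\<lambda>i. if i \<in> I then - 1 else 1 :: real)"
  have "?E * ?E = 1\<^sub>m n"
    unfolding mat_diag_diag by (rule eq_matI) (auto simp: mat_diag_def)
  then have "det ?E * det ?E = 1"
    by (metis det_mult det_one mat_diag_dim)
  then have "\<bar>det ?E\<bar> = 1"
    by (metis abs_mult_self_eq abs_one real_sqrt_abs2 real_sqrt_one)
  moreover have "mat n n (\<lambda>(i, j). if i \<in> I then s j - (if i = j then 1 else 0) else (if i = j then 1 else 0))
      = ?E * ?K"
    by (subst mat_diag_mult_left[of _ n n]) (auto intro!: eq_matI)
  moreover have "det (?E * ?K) = det ?E * det ?K"
    by (rule det_mult[of _ n]) (auto simp: mat_diag_dim)
  moreover have "(\<Sum>i<n. (if i \<in> I then 1 else 0) * s i) = sum s I"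
    using assms by (auto simp: sum.If_cases if_distrib[of "\<lambda>x. x * _"] Int_absorb1 cong: if_cong)
  ultimately show ?thesis
    by (simp add: abs_mult det_one_minus_outer)
qed

section \<open>Simplices of maximal volume and their sumsets\<close>

text \<open>Coordinate 0 of \<open>V\<close> being 1, the rows \<open>V a\<close> are homogeneous
  coordinates, and a determinant of \<open>D\<close> rows is, up to a constant factor and sign, the
  volume of a simplex with \<open>D\<close> vertices.\<close>

lemma card_sumset_simplex:
  fixes G (structure) and V :: "'a \<Rightarrow> nat \<Rightarrow> real"
  assumes G: "group G" and fin: "finite X" and XG: "X \<subseteq> carrier G" and D: "0 < D"
    and hom: "\<And>a b a' b' k. \<lbrakk>a \<in> X; b \<in> X; a' \<in> X; b' \<in> X; a \<otimes> b = a' \<otimes> b'; k < D\<rbrakk>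
      \<Longrightarrow> V a k + V b k = V a' k + V b' k"
    and one: "\<And>a. a \<in> X \<Longrightarrow> V a 0 = 1"
    and p: "p \<in> {..<D} \<rightarrow> X" "det (mat D D (\<lambda>(i, k). V (p i) k)) \<noteq> 0"
  shows "\<exists>B\<subseteq>X. card B = D \<and> (D + 1) * card X \<le> 2 * card (X <#> B)"
proof -
  interpret group G by (rule G)
  define M where "M c = mat D D (\<lambda>(i, k). V (c i) k)" for c
  \<comment> \<open>Extensional functions form a finite set, so the volume attains its maximum on
    it; \<open>p\<close> is restricted to become a member.\<close>
  let ?T = "{..<D} \<rightarrow>\<^sub>E X"
  have M_carrier [simp]: "M c \<in> carrier_mat D D" for c
    by (simp add: M_def)
  have finT: "finite ?T" using fin by (simp add: finite_PiE)
  have pT: "restrict p {..<D} \<in> ?T" using p by auto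
  have Mp: "M (restrict p {..<D}) = mat D D (\<lambda>(i, k). V (p i) k)"
    unfolding M_def by (rule eq_matI) auto
  obtain c where cT: "c \<in> ?T" and c_max: "\<And>c'. c' \<in> ?T \<Longrightarrow> \<bar>det (M c')\<bar> \<le> \<bar>det (M c)\<bar>"
  proof -
    let ?F = "(\<lambda>c. \<bar>det (M c)\<bar>) ` ?T"
    have F: "finite ?F" "?F \<noteq> {}"
      using finT pT by blast+
    then obtain c where "c \<in> ?T" "Max ?F = \<bar>det (M c)\<bar>"
      using Max_in[of ?F] by blast
    then show thesis
      using that[of c] Max_ge[OF F(1)] by auto
  qed
  have det0: "det (M c) \<noteq> 0"
    using c_max[OF pT] p(2) unfolding Mp by auto
  have cX: "c i \<in> X" if "i < D" for i
    using cT that by auto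
  have c_inj: "inj_on c {..<D}"
  proof (rule inj_onI, rule ccontr)
    fix i j assume ij: "i \<in> {..<D}" "j \<in> {..<D}" "c i = c j" "i \<noteq> j"
    have "row (M c) i = row (M c) j"
      using ij by (auto simp: M_def intro!: eq_vecI)
    then show False
      using det_identical_rows[of "M c" D i j] ij det0 by auto
  qed
  obtain R where R: "R \<in> carrier_mat D D" "R * M c = 1\<^sub>m D" "M c * R = 1\<^sub>m D"
    using det_non_zero_imp_unit[OF M_carrier det0, of undefined]
    unfolding Units_def ring_mat_def by auto
  \<comment> \<open>The coordinates of \<open>V a\<close> in the basis of rows of
    \<open>M c\<close>. They are barycentric, since they sum to 1 by \<open>lam_sum\<close>.\<close>
  define lam where "lam a j = (\<Sum>k<D. V a k * R $$ (k, j))" for a j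
  have MR: "M c' * R = mat D D (\<lambda>(i, j). lam (c' i) j)" for c'
    using R(1) by (intro eq_matI) (auto simp: M_def lam_def scalar_prod_def atLeast0LessThan)
  have lam_c: "lam (c i) j = (if i = j then 1 else 0)" if "i < D" "j < D" for i j
  proof -
    have "lam (c i) j = (M c * R) $$ (i, j)"
      unfolding MR using that by simp
    then show ?thesis unfolding R(3) using that by simp
  qed
  have RM: "(\<Sum>j<D. R $$ (k, j) * V (c j) 0) = (if k = 0 then 1 else 0)" if "k < D" for k
  proof -
    have "(R * M c) $$ (k, 0) = (\<Sum>j<D. R $$ (k, j) * V (c j) 0)"
      using that D R(1) by (auto simp: M_def scalar_prod_def atLeast0LessThan)
    then show ?thesis unfolding R(2) using that D by simp
  qed
  have lam_sum: "(\<Sum>j<D. lam a j) = 1" if "a \<in> X" for a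
  proof -
    \<comment> \<open>Inserting the factor \<open>V (c j) 0 = 1\<close> makes column 0 of
      \<open>R * M c\<close>, the identity matrix, appear.\<close>
    have "(\<Sum>j<D. lam a j) = (\<Sum>j<D. \<Sum>k<D. V a k * (R $$ (k, j) * V (c j) 0))"
      unfolding lam_def by (intro sum.cong) (auto simp: one cX)
    also have "\<dots> = (\<Sum>k<D. V a k * (\<Sum>j<D. R $$ (k, j) * V (c j) 0))"
      by (subst sum.swap) (simp add: sum_distrib_left)
    also have "\<dots> = (\<Sum>k<D. if k = 0 then V a k else 0)"
      by (intro sum.cong) (auto simp: RM)
    also have "\<dots> = V a 0"
      using D by simp
    finally show ?thesis using one[OF that] by simp
  qed
  have weight: "(\<Sum>(a, i) | (a, i) \<in> X \<times> {..<D} \<and> a \<otimes> c i = s. 1 + lam a i) \<le> 2" for s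
  proof -
    define P where "P = {(a, i). (a, i) \<in> X \<times> {..<D} \<and> a \<otimes> c i = s}"
    define I where "I = snd ` P"
    have ID: "I \<subseteq> {..<D}" by (auto simp: I_def P_def)
    have "\<forall>i\<in>I. \<exists>a. (a, i) \<in> P" by (auto simp: I_def)
    then obtain \<alpha> where \<alpha>: "\<And>i. i \<in> I \<Longrightarrow> (\<alpha> i, i) \<in> P" by metis
    have \<alpha>X: "\<alpha> i \<in> X" "\<alpha> i \<otimes> c i = s" if "i \<in> I" for i
      using \<alpha>[OF that] by (auto simp: P_def)
    \<comment> \<open>By cancellation, \<open>s\<close> has at most one representation for each
      vertex \<open>c i\<close>.\<close>
    have "a = \<alpha> i" if "(a, i) \<in> P" for a i
    proof -
      have "i \<in> I" using that by (force simp: I_def)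
      then show ?thesis
        using that \<alpha>X[of i] cX[of i] XG by (auto simp: P_def subset_iff)
    qed
    then have P_eq: "P = (\<lambda>i. (\<alpha> i, i)) ` I"
      using \<alpha> by (force simp: I_def)
    have sum_P: "(\<Sum>(a, i)\<in>P. 1 + lam a i) = (\<Sum>i\<in>I. 1 + lam (\<alpha> i) i)"
      unfolding P_eq by (subst sum.reindex) (auto simp: inj_on_def)
    show ?thesis
    proof (cases "I = {}")
      case True
      then show ?thesis using sum_P by (simp add: P_def)
    next
      case False
      then obtain i0 where i0: "i0 \<in> I" by blast
      \<comment> \<open>The coordinates of \<open>s\<close> itself: by \<open>hom\<close> they do
        not depend on the representation. As \<open>c i\<close> has unit coordinates,
        \<open>\<alpha> i\<close> has coordinates \<open>\<sigma>\<close> minus a unit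
        vector.\<close>
      define \<sigma> where "\<sigma> j = lam (\<alpha> i0) j + lam (c i0) j" for j
      have lam_\<alpha>: "lam (\<alpha> i) j = \<sigma> j - (if i = j then 1 else 0)" if "i \<in> I" "j < D" for i j
      proof -
        have "V (\<alpha> i) k + V (c i) k = V (\<alpha> i0) k + V (c i0) k" if "k < D" for k
          using \<alpha>X[OF \<open>i \<in> I\<close>] \<alpha>X[OF i0] cX[of i] cX[of i0] ID \<open>i \<in> I\<close> i0 that
          by (intro hom) auto
        then have "lam (\<alpha> i) j + lam (c i) j = \<sigma> j"
          unfolding \<sigma>_def lam_def sum.distrib[symmetric] distrib_right[symmetric]
          by (intro sum.cong) auto
        then show ?thesis
          using lam_c[of i j] that ID by auto
      qed
      \<comment> \<open>All vertices in \<open>I\<close> are exchanged at once. Multiplying by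
        \<open>R\<close> divides the new volume by the old one, so maximality bounds the ratio by
        1.\<close>
      define c' where "c' = restrict (\<lambda>i. if i \<in> I then \<alpha> i else c i) {..<D}"
      have "c' \<in> ?T" using \<alpha>X cX by (auto simp: c'_def)
      then have le: "\<bar>det (M c')\<bar> \<le> \<bar>det (M c)\<bar>" by (rule c_max)
      have "M c' * R = mat D D (\<lambda>(i, j). if i \<in> I then \<sigma> j - (if i = j then 1 else 0)
          else (if i = j then 1 else 0))"
        unfolding MR by (rule eq_matI) (auto simp: c'_def lam_\<alpha> lam_c)
      then have "\<bar>det (M c') * det R\<bar> = \<bar>1 - sum \<sigma> I\<bar>"
        using abs_det_reflected_rows[OF ID, of \<sigma>] R(1) by (simp add: det_mult[of _ D, symmetric])
      moreover have "\<bar>det (M c) * det R\<bar> = 1"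
        using R by (simp add: det_mult[of _ D, symmetric])
      ultimately have "\<bar>1 - sum \<sigma> I\<bar> \<le> 1"
        using mult_right_mono[OF le, of "\<bar>det R\<bar>"] by (simp add: abs_mult)
      moreover have "(\<Sum>i\<in>I. 1 + lam (\<alpha> i) i) = sum \<sigma> I"
        using ID by (intro sum.cong) (auto simp: lam_\<alpha>)
      ultimately show ?thesis
        using sum_P by (simp add: P_def)
    qed
  qed
  let ?B = "c ` {..<D}"
  let ?g = "\<lambda>(a, i). a \<otimes> c i"
  have finS: "finite (X <#> ?B)"
    using fin by (simp add: set_mult_def)
  \<comment> \<open>Double counting: each \<open>a\<close> contributes \<open>D\<close> ones plus a
    coordinate sum of 1, and each value of the sum absorbs weight at most 2.\<close>
  have "real ((D + 1) * card X) = (\<Sum>a\<in>X. \<Sum>i<D. 1 + lam a i)"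
    by (simp add: sum.distrib lam_sum algebra_simps)
  also have "\<dots> = (\<Sum>(a, i)\<in>X \<times> {..<D}. 1 + lam a i)"
    by (simp add: sum.cartesian_product)
  also have "\<dots> = (\<Sum>s\<in>X <#> ?B. \<Sum>x | x \<in> X \<times> {..<D} \<and> ?g x = s. case x of (a, i) \<Rightarrow> 1 + lam a i)"
    using fin finS by (intro sum.group[symmetric]) (auto simp: set_mult_def)
  also have "\<dots> = (\<Sum>s\<in>X <#> ?B. \<Sum>(a, i) | (a, i) \<in> X \<times> {..<D} \<and> a \<otimes> c i = s. 1 + lam a i)"
    by (intro sum.cong) auto
  also have "\<dots> \<le> (\<Sum>s\<in>X <#> ?B. 2)"
    by (intro sum_mono weight)
  finally have "real ((D + 1) * card X) \<le> real (2 * card (X <#> ?B))"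
    by simp
  then have "(D + 1) * card X \<le> 2 * card (X <#> ?B)"
    by (simp only: of_nat_le_iff)
  moreover have "card ?B = D" "?B \<subseteq> X"
    using c_inj cX by (auto simp: card_image)
  ultimately show ?thesis by blast
qed

section \<open>Full rank sets as nonsingular matrices\<close>

lemma lookup_scaleR_real [simp]:
  "Poly_Mapping.lookup (r *\<^sub>R x) k = r * Poly_Mapping.lookup x k" for x :: "'a \<Rightarrow>\<^sub>0 real"
proof -
  have "finite {i. r *\<^sub>R Poly_Mapping.lookup x i \<noteq> 0}"
    by (rule finite_subset[OF _ finite_keys[of x]]) (auto simp: in_keys_iff)
  then show ?thesis
    by (simp add: scaleR_poly_mapping_def)
qed

lemma lookup_real_vec [simp]:
  "Poly_Mapping.lookup (real_vec v) k = real_of_int (Poly_Mapping.lookup v k)"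
  by (simp add: real_vec_def Poly_Mapping.map.rep_eq when_def)

lemma subspace_real_space: "subspace (real_space d)"
proof -
  have "real_space d = {v. \<forall>k. d \<le> k \<longrightarrow> Poly_Mapping.lookup v k = 0}"
    unfolding real_space_def subset_iff in_keys_iff lessThan_iff by (intro Collect_cong) (meson not_le)
  then show ?thesis
    by (simp add: subspace_def lookup_add)
qed

text \<open>The leading 1 turns affine independence of points into linear independence of
  rows.\<close>

definition homogenize :: "(nat \<Rightarrow>\<^sub>0 real) \<Rightarrow> nat \<Rightarrow> real"
  where "homogenize v k = (case k of 0 \<Rightarrow> 1 | Suc j \<Rightarrow> Poly_Mapping.lookup v j)"

text \<open>The differences from a base point \<open>a\<close> span at least \<open>d\<close>
  dimensions, since otherwise \<open>S\<close> would lie in a smaller translate. Hence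
  \<open>a\<close> and its translates by \<open>d\<close> independent differences are affinely
  independent.\<close>

lemma full_rank_det:
  assumes "full_rank d S" "S \<noteq> {}"
  obtains q where "q \<in> {..<Suc d} \<rightarrow> S"
    "det (mat (Suc d) (Suc d) (\<lambda>(i, k). homogenize (q i) k)) \<noteq> 0"
proof -
  obtain a where a: "a \<in> S" using assms(2) by blast
  have S: "S \<subseteq> real_space d" using assms(1) by (simp add: full_rank_def)
  let ?T = "(\<lambda>x. x - a) ` S"
  obtain B where B: "B \<subseteq> ?T" "independent B" "?T \<subseteq> span B"
    by (rule real_vector.maximal_independent_subset)
  have "span B \<subseteq> real_space d"
    using B(1) a S by (intro span_minimal subspace_real_space) (auto intro!: subspace_diff subspace_real_space)
  moreover have "S \<subseteq> (+) a ` span B"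
  proof
    fix x assume "x \<in> S"
    then have "x - a \<in> span B" using B(3) by blast
    then have "a + (x - a) \<in> (+) a ` span B" by (rule imageI)
    then show "x \<in> (+) a ` span B" by simp
  qed
  ultimately have "d \<le> dim (span B)"
    using assms(1) a S unfolding full_rank_def by (meson not_le subsetD subspace_span)
  then have "d \<le> card B"
    using B(2) by (simp add: dim_eq_card_independent)
  then obtain B' where B': "B' \<subseteq> B" "card B' = d" "finite B'"
    by (metis obtain_subset_with_card_n)
  have indep: "independent B'"
    using B(2) B'(1) independent_mono by blast
  obtain f where f: "bij_betw f {..<d} B'"
    using B'(2,3) ex_bij_betw_nat_finite[of B'] by (auto simp: atLeast0LessThan)
  define q where "q i = (case i of 0 \<Rightarrow> a | Suc j \<Rightarrow> a + f j)" for i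
  have "a + f j \<in> S" if "j < d" for j
    using bij_betwE[OF f] that B'(1) B(1) by force
  then have "q \<in> {..<Suc d} \<rightarrow> S"
    using a by (auto simp: q_def split: nat.splits)
  moreover have "det (mat (Suc d) (Suc d) (\<lambda>(i, k). homogenize (q i) k)) \<noteq> 0" (is "det ?M \<noteq> 0")
  proof
    assume "det ?M = 0"
    then have "det (transpose_mat ?M) = 0"
      by (subst det_transpose[of _ "Suc d"]) auto
    \<comment> \<open>The entries of \<open>v\<close> are the coefficients of a linear relation
      among the rows. Column 0 makes them sum to 0, so the base point cancels from the other columns
      and a relation among the \<open>f j\<close> remains.\<close>
    then obtain v where v: "v \<in> carrier_vec (Suc d)" "v \<noteq> 0\<^sub>v (Suc d)"
      "transpose_mat ?M *\<^sub>v v = 0\<^sub>v (Suc d)"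
      using det_0_iff_vec_prod_zero[of "transpose_mat ?M" "Suc d"] by auto
    have comb: "(\<Sum>i<Suc d. v $ i * homogenize (q i) k) = 0" if "k < Suc d" for k
    proof -
      have "(transpose_mat ?M *\<^sub>v v) $ k = 0" using v(3) that by simp
      then show ?thesis
        using that v(1) by (simp add: scalar_prod_def atLeast0LessThan mult.commute)
    qed
    have v0: "(\<Sum>i<Suc d. v $ i) = 0"
      using comb[of 0] by (simp add: homogenize_def)
    have "(\<Sum>j<d. v $ Suc j *\<^sub>R f j) = 0"
    proof (rule poly_mapping_eqI)
      fix k
      show "Poly_Mapping.lookup (\<Sum>j<d. v $ Suc j *\<^sub>R f j) k = Poly_Mapping.lookup 0 k"
      proof (cases "k < d")
        case True
        have "(\<Sum>i<Suc d. v $ i * homogenize (q i) (Suc k)) = 0"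
          using True by (intro comb) simp
        then have "0 = (\<Sum>i<Suc d. v $ i * Poly_Mapping.lookup (q i) k)"
          unfolding homogenize_def nat.case by (rule sym)
        also have "\<dots> = v $ 0 * Poly_Mapping.lookup a k
            + (\<Sum>j<d. v $ Suc j * (Poly_Mapping.lookup a k + Poly_Mapping.lookup (f j) k))"
          unfolding sum.lessThan_Suc_shift by (simp add: q_def lookup_add)
        also have "\<dots> = (\<Sum>i<Suc d. v $ i) * Poly_Mapping.lookup a k
            + (\<Sum>j<d. v $ Suc j * Poly_Mapping.lookup (f j) k)"
          unfolding sum.lessThan_Suc_shift
          by (simp add: distrib_left distrib_right sum.distrib sum_distrib_right del: sum.lessThan_Suc)
        finally show ?thesis
          unfolding v0 by (simp add: lookup_sum)
      next
        case False
        have "Poly_Mapping.lookup (f j) k = 0" if "j < d" for j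
        proof -
          have "f j \<in> real_space d"
            using bij_betwE[OF f] that B'(1) \<open>span B \<subseteq> real_space d\<close> span_superset by blast
          then show ?thesis using False by (force simp: real_space_def in_keys_iff)
        qed
        then show ?thesis by (simp add: lookup_sum)
      qed
    qed
    \<comment> \<open>\<open>independentD\<close> wants coefficients indexed by the vectors
      themselves, hence the inverse of \<open>f\<close>.\<close>
    also have "(\<Sum>j<d. v $ Suc j *\<^sub>R f j) = (\<Sum>j<d. v $ Suc (inv_into {..<d} f (f j)) *\<^sub>R f j)"
      using f by (intro sum.cong) (auto simp: bij_betw_def)
    also have "\<dots> = (\<Sum>b\<in>B'. v $ Suc (inv_into {..<d} f b) *\<^sub>R b)"
      by (rule sum.reindex_bij_betw[OF f])
    finally have "v $ Suc (inv_into {..<d} f b) = 0" if "b \<in> B'" for b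
      using real_vector.independentD[OF indep \<open>finite B'\<close> subset_refl,
          where u = "\<lambda>b. v $ Suc (inv_into {..<d} f b)"] that by simp
    then have vS: "v $ Suc j = 0" if "j < d" for j
      using that f by (metis bij_betw_def bij_betwE inv_into_f_f lessThan_iff)
    then have "v $ 0 = 0"
      using v0 unfolding sum.lessThan_Suc_shift by simp
    then have "v = 0\<^sub>v (Suc d)"
      using v(1) vS by (intro eq_vecI) (auto simp: less_Suc_eq_0_disj)
    then show False using v(2) by blast
  qed
  ultimately show thesis by (rule that)
qed

section \<open>From Freiman dimension to sumsets\<close>

text \<open>Positivity of \<open>d\<close> excludes the empty set of dimensions, whose
  \<open>Sup\<close> is 0. A finite nonempty set attains its \<open>Sup\<close>, and an infinite one
  has members beyond any bound.\<close>

lemma freiman_dim_witness: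
  assumes "d \<le> freiman_dim G X" "0 < d"
  obtains d' S \<phi> where "d \<le> d'" "full_rank d' (real_vec ` S)" "freiman_iso G (int_space d') X S \<phi>"
proof -
  define A where "A = {d. \<exists>S \<phi>. S \<subseteq> carrier (int_space d) \<and> full_rank d (real_vec ` S) \<and>
                  freiman_iso G (int_space d) X S \<phi>}"
  have dA: "d \<le> Sup A" using assms(1) by (simp add: freiman_dim_def A_def)
  have "\<exists>d'\<in>A. d \<le> d'"
  proof (cases "finite A")
    case True
    moreover have "A \<noteq> {}" using dA assms(2) by auto
    ultimately show ?thesis
      using dA by (intro bexI[of _ "Max A"]) (auto simp: Sup_nat_def)
  next
    case False
    then show ?thesis
      by (meson infinite_nat_iff_unbounded_le)
  qed
  then obtain d' where "d' \<in> A" "d \<le> d'" by blast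
  then obtain S \<phi> where "full_rank d' (real_vec ` S)" "freiman_iso G (int_space d') X S \<phi>"
    unfolding A_def mem_Collect_eq by (elim exE conjE)
  then show thesis by (rule that[OF \<open>d \<le> d'\<close>])
qed

text \<open>The witnessing dimension may exceed \<open>d\<close>, so \<open>D\<close> is only
  bounded below. This is harmless later, as gain and loss are both proportional to the number
  \<open>D\<close> of translates.\<close>

lemma card_sumset_few_translates:
  fixes G (structure)
  assumes "group G" "finite X" "X \<subseteq> carrier G" "X \<noteq> {}" "d \<le> freiman_dim G X"
  shows "\<exists>D B. d < D \<and> B \<subseteq> X \<and> card B = D \<and> D * card X \<le> 2 * card (X <#> B)"
proof (cases "d = 0")
  \<comment> \<open>Here the dimension may be the default 0, with no integer model available; a
    single translate suffices.\<close>
  case True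
  interpret group G by fact
  obtain b where b: "b \<in> X" using assms by blast
  have "X <#> {b} = (\<lambda>a. a \<otimes> b) ` X" by (auto simp: set_mult_def)
  moreover have "inj_on (\<lambda>a. a \<otimes> b) X"
    using assms(3) b by (auto simp: inj_on_def subset_iff)
  ultimately have "card (X <#> {b}) = card X" by (simp add: card_image)
  then show ?thesis
    using True b by (intro exI[of _ 1] exI[of _ "{b}"]) auto
next
  case False
  then obtain d' S \<phi> where d': "d \<le> d'" "full_rank d' (real_vec ` S)" "freiman_iso G (int_space d') X S \<phi>"
    using freiman_dim_witness[of d G X] assms by blast
  have \<phi>: "\<phi> ` X = S" and \<phi>_hom: "freiman_hom G (int_space d') X S \<phi>"
    using d'(3) by (auto simp: freiman_iso_def bij_betw_def)
  have "real_vec ` S \<noteq> {}" using \<phi> assms(4) by auto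
  then obtain q where q: "q \<in> {..<Suc d'} \<rightarrow> real_vec ` S"
    "det (mat (Suc d') (Suc d') (\<lambda>(i, k). homogenize (q i) k)) \<noteq> 0"
    using full_rank_det[OF d'(2)] by blast
  have "\<forall>i\<in>{..<Suc d'}. \<exists>x\<in>X. q i = real_vec (\<phi> x)"
  proof
    fix i assume "i \<in> {..<Suc d'}"
    then have "q i \<in> real_vec ` \<phi> ` X" unfolding \<phi> using q(1) by blast
    then show "\<exists>x\<in>X. q i = real_vec (\<phi> x)" by blast
  qed
  then obtain p where p: "\<And>i. i < Suc d' \<Longrightarrow> p i \<in> X \<and> q i = real_vec (\<phi> (p i))"
    by (metis lessThan_iff)
  have "mat (Suc d') (Suc d') (\<lambda>(i, k). homogenize (q i) k)
      = mat (Suc d') (Suc d') (\<lambda>(i, k). homogenize (real_vec (\<phi> (p i))) k)"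
    using p by (intro eq_matI) auto
  then have det: "det (mat (Suc d') (Suc d') (\<lambda>(i, k). homogenize (real_vec (\<phi> (p i))) k)) \<noteq> 0"
    using q(2) by simp
  have hom: "homogenize (real_vec (\<phi> a)) k + homogenize (real_vec (\<phi> b)) k
      = homogenize (real_vec (\<phi> a')) k + homogenize (real_vec (\<phi> b')) k"
    if "a \<in> X" "b \<in> X" "a' \<in> X" "b' \<in> X" "a \<otimes> b = a' \<otimes> b'" for a b a' b' k
  proof -
    have "\<phi> a \<otimes>\<^bsub>int_space d'\<^esub> \<phi> b = \<phi> a' \<otimes>\<^bsub>int_space d'\<^esub> \<phi> b'"
      using \<phi>_hom that unfolding freiman_hom_def by blast
    then have "\<phi> a + \<phi> b = \<phi> a' + \<phi> b'" by simp
    then have "Poly_Mapping.lookup (\<phi> a) j + Poly_Mapping.lookup (\<phi> b) j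
        = Poly_Mapping.lookup (\<phi> a') j + Poly_Mapping.lookup (\<phi> b') j" for j
      by (metis lookup_add)
    then show ?thesis
      by (auto simp: homogenize_def simp flip: of_int_add split: nat.split)
  qed
  have "\<exists>B\<subseteq>X. card B = Suc d' \<and> (Suc d' + 1) * card X \<le> 2 * card (X <#> B)"
    by (rule card_sumset_simplex[where V = "\<lambda>x. homogenize (real_vec (\<phi> x))", OF assms(1-3) _ hom _ _ det])
      (use p in \<open>auto simp: homogenize_def\<close>)
  then obtain B where B: "B \<subseteq> X" "card B = Suc d'" "(Suc d' + 1) * card X \<le> 2 * card (X <#> B)"
    by blast
  have "d < Suc d'" using d'(1) by simp
  moreover have "Suc d' * card X \<le> 2 * card (X <#> B)"
    by (rule order_trans[OF _ B(3)]) (rule mult_le_mono1, simp)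
  ultimately show ?thesis
    using B(1,2) by (intro exI[of _ "Suc d'"] exI[of _ B] conjI)
qed

section \<open>Robustness and missing sums\<close>

text \<open>Of the total relative loss \<open>\<gamma>\<close>, one half comes from shrinking
  \<open>X\<close> to \<open>X'\<close>. The other half comes from missing sums: at most
  \<open>\<gamma> / 4 * N\<close> per translate, doubled by the factor 2 in the sumset
  bound.\<close>

lemma card_popular_sums:
  fixes G (structure)
  assumes G: "group G" and fin: "finite X" and XG: "X \<subseteq> carrier G"
    and \<gamma>: "0 < \<gamma>" "\<gamma> < 1" and \<epsilon>: "0 < \<epsilon>" "\<epsilon> < 1"
    and robust: "robust_freiman_dim G \<epsilon> X d" and finY: "finite Y"
    and missing: "real (card {(a, b). a \<in> X \<and> b \<in> X \<and> a \<otimes> b \<notin> Y}) \<le> \<gamma>\<^sup>2 / 8 * \<epsilon> * (real (card X))\<^sup>2"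
  shows "(1 - \<gamma>) * (real d + 1) * real (card X) / 2 \<le> real (card Y)"
proof (cases "X = {}")
  case True
  then show ?thesis by simp
next
  case False
  define N where "N = real (card X)"
  have N: "0 < N" using False fin by (simp add: N_def card_gt_0_iff)
  define miss where "miss b = {a \<in> X. a \<otimes> b \<notin> Y}" for b
  have fin_miss: "finite (miss b)" for b using fin by (simp add: miss_def)
  define Z where "Z = {b \<in> X. \<gamma> / 4 * N < real (card (miss b))}"
  have finZ: "finite Z" "Z \<subseteq> X" using fin by (auto simp: Z_def)
  have "real (card Z) * (\<gamma> / 4 * N) \<le> (\<Sum>b\<in>Z. real (card (miss b)))"
    by (rule sum_bounded_below) (auto simp: Z_def)
  also have "\<dots> = real (card (SIGMA b:Z. miss b))"
    using finZ fin_miss by (simp add: card_SigmaI)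
  also have "\<dots> \<le> real (card {(a, b). a \<in> X \<and> b \<in> X \<and> a \<otimes> b \<notin> Y})"
  proof -
    have "finite {(a, b). a \<in> X \<and> b \<in> X \<and> a \<otimes> b \<notin> Y}"
      by (rule finite_subset[of _ "X \<times> X"]) (use fin in auto)
    then have "card (prod.swap ` (SIGMA b:Z. miss b)) \<le> card {(a, b). a \<in> X \<and> b \<in> X \<and> a \<otimes> b \<notin> Y}"
      by (rule card_mono) (use finZ in \<open>auto simp: miss_def\<close>)
    then show ?thesis by (simp add: card_image)
  qed
  \<comment> \<open>The constant splits as \<open>\<gamma> / 2\<close> times
    \<open>\<gamma> / 4\<close>; cancelling the threshold that defines \<open>Z\<close> leaves a
    bound on \<open>card Z\<close>.\<close>
  also have "\<dots> \<le> (\<gamma> / 2 * \<epsilon> * N) * (\<gamma> / 4 * N)"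
    using missing by (simp add: N_def power2_eq_square algebra_simps)
  finally have Z_le: "real (card Z) \<le> \<gamma> / 2 * \<epsilon> * N"
    using \<gamma> N by (auto simp: mult_le_cancel_right algebra_simps)
  define X' where "X' = X - Z"
  have X': "X' \<subseteq> X" "finite X'" using fin by (auto simp: X'_def)
  have "card Z \<le> card X" using fin finZ(2) by (rule card_mono)
  then have card_X': "real (card X') = N - real (card Z)"
    using finZ by (simp add: X'_def N_def card_Diff_subset)
  \<comment> \<open>The bound on \<open>Z\<close> serves twice: against
    \<open>\<epsilon> * N\<close>, so that robustness applies to \<open>X'\<close>, and below
    against \<open>\<gamma> / 2 * N\<close>, so that little of \<open>X\<close> is lost.\<close>
  have "\<gamma> / 2 * \<epsilon> * N \<le> 1 * \<epsilon> * N"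
    using \<gamma> \<epsilon> N by (intro mult_right_mono) auto
  then have "(1 - \<epsilon>) * N \<le> real (card X')"
    using Z_le card_X' by (simp add: algebra_simps)
  then have dim: "d \<le> freiman_dim G X'"
    using robust X' unfolding robust_freiman_dim_def N_def by (meson not_le)
  have "\<gamma> / 2 * \<epsilon> * N \<le> \<gamma> / 2 * 1 * N"
    using \<gamma> \<epsilon> N by (intro mult_right_mono mult_left_mono) auto
  then have card_X'_ge: "(1 - \<gamma> / 2) * N \<le> real (card X')"
    using Z_le card_X' by (simp add: algebra_simps)
  moreover have "0 < (1 - \<gamma> / 2) * N" using \<gamma> N by simp
  ultimately have "X' \<noteq> {}" by auto
  then obtain D B where D: "d < D" "B \<subseteq> X'" "card B = D" "D * card X' \<le> 2 * card (X' <#> B)"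
    using card_sumset_few_translates[OF G X'(2) _ _ dim] X' XG by blast
  have finB: "finite B" using D(2) X'(2) by (rule finite_subset)
  \<comment> \<open>A sum outside \<open>Y\<close> lies in a translate of some
    \<open>miss b\<close>, which is small because \<open>B\<close> avoids \<open>Z\<close>.\<close>
  have "X' <#> B \<subseteq> Y \<union> (\<Union>b\<in>B. (\<lambda>a. a \<otimes> b) ` miss b)"
    using X'(1) by (auto simp: set_mult_def miss_def)
  then have "card (X' <#> B) \<le> card (Y \<union> (\<Union>b\<in>B. (\<lambda>a. a \<otimes> b) ` miss b))"
    using finY finB fin_miss by (intro card_mono) auto
  also have "\<dots> \<le> card Y + card (\<Union>b\<in>B. (\<lambda>a. a \<otimes> b) ` miss b)"
    by (rule card_Un_le)
  also have "card (\<Union>b\<in>B. (\<lambda>a. a \<otimes> b) ` miss b) \<le> (\<Sum>b\<in>B. card ((\<lambda>a. a \<otimes> b) ` miss b))"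
    by (rule card_UN_le[OF finB])
  also have "\<dots> \<le> (\<Sum>b\<in>B. card (miss b))"
    using fin_miss by (intro sum_mono card_image_le)
  finally have "real (card (X' <#> B)) \<le> real (card Y) + (\<Sum>b\<in>B. real (card (miss b)))"
    by (simp flip: of_nat_sum of_nat_add)
  also have "(\<Sum>b\<in>B. real (card (miss b))) \<le> real (card B) * (\<gamma> / 4 * N)"
    using D(2) by (intro sum_bounded_above) (auto simp: X'_def Z_def not_less)
  finally have "2 * real (card (X' <#> B)) \<le> 2 * real (card Y) + real D * (\<gamma> / 2 * N)"
    using D(3) by simp
  moreover have "real D * real (card X') \<le> 2 * real (card (X' <#> B))"
    using D(4) by (metis of_nat_le_iff of_nat_mult of_nat_numeral)
  moreover have "real D * ((1 - \<gamma> / 2) * N) \<le> real D * real (card X')"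
    using card_X'_ge by (intro mult_left_mono) auto
  moreover have "(real d + 1) * ((1 - \<gamma>) * N) \<le> real D * ((1 - \<gamma>) * N)"
    using D(1) \<gamma> N by (intro mult_right_mono) auto
  ultimately show ?thesis
    unfolding N_def by (simp add: algebra_simps)
qed

section \<open>Specialisation to residues modulo a prime\<close>

theorem theorem2p2:
  shows "\<exists>n0::nat. \<forall>\<gamma>::real. 0 < \<gamma> \<and> \<gamma> < 1 \<longrightarrow>
    (\<exists>c::real. c > 0 \<and> (\<exists>m::nat. \<forall>n::nat. n \<ge> n0 \<and> prime n \<longrightarrow>
      (\<forall>X. X \<subseteq> carrier (integer_mod_group n) \<and> card X \<ge> m \<longrightarrow>
        (\<forall>(d::nat) (\<epsilon>::real) Y.
          0 < \<epsilon> \<and> \<epsilon> < \<gamma> \<and>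
          robust_freiman_dim (integer_mod_group n) \<epsilon> X d \<and>
          Y \<subseteq> X <#>\<^bsub>integer_mod_group n\<^esub> X \<and>
          real (card {(x1, x2). x1 \<in> X \<and> x2 \<in> X \<and> x1 \<otimes>\<^bsub>integer_mod_group n\<^esub> x2 \<notin> Y})
            \<le> c * \<epsilon> * (real (card X))\<^sup>2 \<longrightarrow>
          real (card Y) \<ge> (1 - \<gamma>) * (real d + 1) * real (card X) / 2))))"
proof (intro exI[of _ "0 :: nat"] allI impI, goal_cases)
  case \<gamma>: (1 \<gamma>)
  show ?case
  \<comment> \<open>Both size thresholds are taken to be 0: the bound holds for every prime and
    every \<open>X\<close>.\<close>
  proof (intro exI[of _ "\<gamma>\<^sup>2 / 8"] conjI exI[of _ "0 :: nat"] allI impI, goal_cases)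
    case 1
    then show ?case using \<gamma> by simp
  next
    case (2 n X d \<epsilon> Y)
    let ?G = "integer_mod_group n"
    \<comment> \<open>Modulus 0 would give the infinite group of integers; primality rules it
      out.\<close>
    have "n \<noteq> 0" using 2 by auto
    then have "finite (carrier ?G)" by (simp add: carrier_integer_mod_group)
    then have finX: "finite X" using 2 by (auto intro: finite_subset)
    then have "finite (X <#>\<^bsub>?G\<^esub> X)" by (simp add: set_mult_def)
    then have finY: "finite Y" using 2 by (auto intro: finite_subset)
    show ?case
      by (rule card_popular_sums[where \<epsilon> = \<epsilon>, OF group_integer_mod_group finX _ _ _ _ _ _ finY])
        (use 2 \<gamma> in linarith | use 2 in blast)+
  qed
qed

end
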